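(* Let $X$ be a $T_1$ topological space. If $X$ is perfectly normal, then $C(X)_F \subseteq B_1(X)$.
   Context: $C(X)_F$ denotes the ring of all functions $f : X \to \mathbb{R}$ for which there is a finite subset $F \subseteq X$ such that the restriction $f|_{X\setminus F}$ is continuous on the subspace $X \setminus F$. $B_1(X)$ denotes the ring of all real valued Baire class one functions on $X$, i.e. the functions $f : X \to \mathbb{R}$ that are pointwise limits of sequences of continuous functions $X \to \mathbb{R}$. A topological space is called perfectly normal if it is normal and every closed subset is a $G_\delta$-set. *)

theory Defs
  imports "HOL-Analysis.Analysis"
begin

definition perfectly_normal_space :: "'a topology \<Rightarrow> bool" where
  "perfectly_normal_space X \<longleftrightarrow>
     normal_space X \<and> (\<forall>S. closedin X S \<longrightarrow> gdelta_in X S)"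

text \<open>A function from the space \<open>X\<close> to the reals is represented by its
  extensional representative: it takes the value \<^term>\<open>undefined\<close> outside
  \<open>topspace X\<close>.\<close>

definition C_F :: "'a topology \<Rightarrow> ('a \<Rightarrow> real) set" where
  "C_F X = {f \<in> topspace X \<rightarrow>\<^sub>E UNIV.
     \<exists>F. finite F \<and> F \<subseteq> topspace X \<and>
         continuous_map (subtopology X (topspace X - F)) euclideanreal f}"

definition Baire_one :: "'a topology \<Rightarrow> ('a \<Rightarrow> real) set" where
  "Baire_one X = {f \<in> topspace X \<rightarrow>\<^sub>E UNIV.
     \<exists>g :: nat \<Rightarrow> 'a \<Rightarrow> real.
       (\<forall>n. continuous_map X euclideanreal (g n)) \<and>
       (\<forall>x \<in> topspace X. (\<lambda>n. g n x) \<longlonglongrightarrow> f x)}"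

end

theory Submission
  imports Defs
begin

text \<open>
  The exceptional set \<open>F\<close> of a function \<open>f\<close> in \<open>C_F X\<close> is finite, so in a \<open>T\<^sub>1\<close> space it is
  closed and discrete, and \<open>f\<close> is continuous on it. Since \<open>F\<close> is a \<open>G\<^sub>\<delta>\<close>-set, its complement is
  an increasing union of closed sets \<open>K n\<close>. The disjoint closed sets \<open>K n\<close> and \<open>F\<close> paste together,
  so \<open>f\<close> is continuous on the closed set \<open>K n \<union> F\<close>, and by Tietze's theorem it agrees there with a
  continuous function \<open>g n\<close> on the whole space. Every point of \<open>X\<close> lies in \<open>K n \<union> F\<close> for all large
  \<open>n\<close>, so the sequence \<open>g\<close> is eventually constant, equal to \<open>f\<close>, at every point.
\<close>

lemma continuous_map_subtopology_Un_closed: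
  assumes S: "closedin X S" and T: "closedin X T"
    and fS: "continuous_map (subtopology X S) Y f"
    and fT: "continuous_map (subtopology X T) Y f"
  shows "continuous_map (subtopology X (S \<union> T)) Y f"
proof (rule pasting_lemma_closed [where I = "{S, T}" and T = "\<lambda>A. A" and f = "\<lambda>_. f"])
  fix A assume A: "A \<in> {S, T}"
  then show "closedin (subtopology X (S \<union> T)) A"
    using S T by (auto intro: closedin_subset_topspace)
  have "(S \<union> T) \<inter> A = A"
    using A by blast
  then show "continuous_map (subtopology (subtopology X (S \<union> T)) A) Y f"
    using A fS fT by (auto simp: subtopology_subtopology)
qed auto

lemma continuous_map_finite_t1_space:
  assumes "t1_space X" and "finite F" and "F \<subseteq> topspace X" and "f \<in> F \<rightarrow> topspace Y"
  shows "continuous_map (subtopology X F) Y f"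
proof -
  have "topspace (subtopology X F) = F"
    using assms by auto
  then have "subtopology X F = discrete_topology F"
    using finite_t1_space_imp_discrete_topology [of "subtopology X F"] assms
    by (simp add: t1_space_subtopology)
  then show ?thesis
    using assms by simp
qed

text \<open>Finiteness of the exceptional set enters only through the continuity of \<open>f\<close> on it: any
  closed \<open>G\<^sub>\<delta>\<close>-set \<open>F\<close> such that \<open>f\<close> is continuous both on \<open>F\<close> and on its complement will do.\<close>

lemma pointwise_limit_of_continuous_maps_closed_gdelta:
  fixes f :: "'a \<Rightarrow> real"
  assumes X: "normal_space X" and F: "closedin X F" "gdelta_in X F"
    and fF: "continuous_map (subtopology X F) euclideanreal f"
    and fC: "continuous_map (subtopology X (topspace X - F)) euclideanreal f"
  obtains g :: "nat \<Rightarrow> 'a \<Rightarrow> real"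
  where "\<And>n. continuous_map X euclideanreal (g n)"
    and "\<And>x. x \<in> topspace X \<Longrightarrow> (\<lambda>n. g n x) \<longlonglongrightarrow> f x"
proof -
  have "fsigma_in X (topspace X - F)"
    using F(2) by (simp add: gdelta_in_fsigma_in)
  then obtain K where K: "\<And>n. closedin X (K n)" "\<And>n. K n \<subseteq> K (Suc n)"
      "\<Union> (range K) = topspace X - F"
    by (meson fsigma_in_ascending)
  have "\<exists>h. continuous_map X euclideanreal h \<and> (\<forall>x \<in> K n \<union> F. h x = f x)" for n
  proof -
    have "K n \<subseteq> topspace X - F"
      using K(3) by blast
    then have "continuous_map (subtopology X (K n)) euclideanreal f"
      using fC continuous_map_from_subtopology_mono by blast
    then have "continuous_map (subtopology X (K n \<union> F)) euclideanreal f"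
      using K(1) F(1) fF by (intro continuous_map_subtopology_Un_closed)
    moreover have "closedin X (K n \<union> F)"
      using K(1) F(1) by (rule closedin_Un)
    ultimately show ?thesis
      using X unfolding normal_space_iff_Tietze by blast
  qed
  then obtain g where g: "\<And>n. continuous_map X euclideanreal (g n)"
      and gf: "\<And>n x. x \<in> K n \<union> F \<Longrightarrow> g n x = f x"
    by metis
  have "(\<lambda>n. g n x) \<longlonglongrightarrow> f x" if x: "x \<in> topspace X" for x
  proof -
    obtain N where N: "x \<in> K N \<union> F"
      using x K(3) by blast
    have "g n x = f x" if "n \<ge> N" for n
      using N gf lift_Suc_mono_le [of K, OF K(2) that] by blast
    then show ?thesis
      by (intro tendsto_eventually eventually_sequentiallyI)
  qed
  with g that show ?thesis
    by blast
qed

theorem theorem2p6: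
  fixes X :: "'a topology"
  assumes "t1_space X"
    and "perfectly_normal_space X"
  shows "C_F X \<subseteq> Baire_one X"
proof
  fix f assume "f \<in> C_F X"
  then obtain F where f: "f \<in> topspace X \<rightarrow>\<^sub>E UNIV" and F: "finite F" "F \<subseteq> topspace X"
    and fC: "continuous_map (subtopology X (topspace X - F)) euclideanreal f"
    unfolding C_F_def by blast
  have "closedin X F"
    using assms(1) F by (simp add: t1_space_closedin_finite)
  moreover have "normal_space X" "gdelta_in X F"
    using assms(2) \<open>closedin X F\<close> by (auto simp: perfectly_normal_space_def)
  moreover have "continuous_map (subtopology X F) euclideanreal f"
    using assms(1) F by (simp add: continuous_map_finite_t1_space)
  ultimately obtain g :: "nat \<Rightarrow> 'a \<Rightarrow> real"
    where "\<And>n. continuous_map X euclideanreal (g n)"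
      and "\<And>x. x \<in> topspace X \<Longrightarrow> (\<lambda>n. g n x) \<longlonglongrightarrow> f x"
    using fC by (metis pointwise_limit_of_continuous_maps_closed_gdelta)
  with f show "f \<in> Baire_one X"
    unfolding Baire_one_def by blast
qed

end
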